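(* Let $\mathcal{A}$ be the free unital algebra over $\mathbb{C}$ on two generators $x,y$, let $n\in\mathbb{N}$, and put $v:=1-xy$, $w:=1-yx$, $\omega_n:=x+vx+\cdots+v^{n-1}x$. Let $\mathcal{I}_n\subset\mathcal{A}$ be the smallest ideal containing $v^n$ and $w^n$, and let $\mathcal{J}_n\subset\mathcal{A}$ be the ideal generated by $w^n-v^n$. Define $$\gamma_2:=-w^n\otimes y\otimes\omega_n+v^n\otimes\omega_n\otimes y-\omega_n\otimes w^n\otimes y+\omega_n\otimes y\otimes v^n-2(w^n-v^n)\otimes1\otimes1\in C_2(\mathcal{A},\mathcal{I}_n),$$ $$\gamma_0:=w^n-v^n\in\mathcal{J}_n.$$ Then the 2-chain $\gamma:=(\gamma_2,\gamma_0)$ is a 2-cycle in the concatenation $\mathcal{B}_*(\mathcal{I}_n,\mathcal{J}_n,\mathcal{A})$.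
   Context: Ideals are two-sided; $\mathbb{N}=\{1,2,\dots\}$. For a unital algebra $\mathcal{A}$, $C_k(\mathcal{A})=\mathcal{A}^{\otimes(k+1)}$ for $k\ge0$, and $C_{-1}(\mathcal A)=\{0\}$. The Hochschild boundary is $b(x_0\otimes\cdots\otimes x_k)=\sum_{i=0}^{k-1}(-1)^ix_0\otimes\cdots\otimes x_ix_{i+1}\otimes\cdots\otimes x_k+(-1)^kx_kx_0\otimes x_1\otimes\cdots\otimes x_{k-1}$. With $t(x_0\otimes\cdots\otimes x_k)=(-1)^kx_k\otimes x_0\otimes\cdots\otimes x_{k-1}$, $N=1+t+\cdots+t^k$ and $s(x_0\otimes\cdots\otimes x_k)=1\otimes x_0\otimes\cdots\otimes x_k$, the Connes boundary is $B=(1-t)sN:C_k(\mathcal{A})\to C_{k+1}(\mathcal{A})$. For an ideal $\mathcal{I}\subset\mathcal{A}$, $C_k(\mathcal{A},\mathcal{I})\subset C_k(\mathcal{A})$ is the sum of the subspaces $\mathcal{I}\otimes\mathcal{A}\otimes\cdots\otimes\mathcal{A}+\cdots+\mathcal{A}\otimes\cdots\otimes\mathcal{A}\otimes\mathcal{I}$ ($\mathcal{A}$ appearing $k$ times in each); $b$ and $B$ restrict to these subspaces. For ideals $\mathcal{J}\subset\mathcal{I}\subset\mathcal{A}$, the concatenation is the bicomplex whose $0$th column is $(C_*(\mathcal{A},\mathcal{I}),b)$, whose columns $m\ge1$ are copies of $(C_*(\mathcal{A},\mathcal{J}),b)$ (with $C_{k-m}(\mathcal{A},\mathcal{J})$ in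 row $k$, column $m$), and whose horizontal boundary is $B$ (from column 1 to column 0 it is $B:C_k(\mathcal{A},\mathcal{J})\to C_{k+1}(\mathcal{A},\mathcal{I})$). Its totalization $\mathcal{B}_*(\mathcal{I},\mathcal{J},\mathcal{A})$ has chains $C_k(\mathcal{A},\mathcal{I})\oplus C_{k-2}(\mathcal{A},\mathcal{J})\oplus C_{k-4}(\mathcal{A},\mathcal{J})\oplus\cdots$ in degree $k$ and boundary $(z_k,z_{k-2},\dots)\mapsto(b(z_k)+B(z_{k-2}),\,b(z_{k-2})+B(z_{k-4}),\dots)$. *)

theory Defs
  imports Complex_Main "HOL-Library.Poly_Mapping"
begin

section \<open>Complex vector spaces and unital complex algebras\<close>

class complex_vector = ab_group_add +
  fixes scaleC :: "complex \<Rightarrow> 'a \<Rightarrow> 'a" (infixr \<open>*\<^sub>C\<close> 75)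
  assumes scaleC_add_right: "a *\<^sub>C (x + y) = a *\<^sub>C x + a *\<^sub>C y"
    and scaleC_add_left: "(a + b) *\<^sub>C x = a *\<^sub>C x + b *\<^sub>C x"
    and scaleC_scaleC: "a *\<^sub>C b *\<^sub>C x = (a * b) *\<^sub>C x"
    and scaleC_one: "1 *\<^sub>C x = x"

class complex_algebra_1 = complex_vector + ring_1 +
  assumes mult_scaleC_left: "a *\<^sub>C x * y = a *\<^sub>C (x * y)"
    and mult_scaleC_right: "x * a *\<^sub>C y = a *\<^sub>C (x * y)"

interpretation cvec: vector_space "scaleC :: complex \<Rightarrow> 'a \<Rightarrow> 'a::complex_vector"
  by unfold_locales (simp_all add: scaleC_add_right scaleC_add_left scaleC_scaleC scaleC_one)

definition clinear :: "('a::complex_vector \<Rightarrow> 'b::complex_vector) \<Rightarrow> bool" where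
  "clinear f \<longleftrightarrow> (\<forall>x y. f (x + y) = f x + f y) \<and> (\<forall>c x. f (c *\<^sub>C x) = c *\<^sub>C f x)"

instantiation complex :: complex_algebra_1
begin

definition scaleC_complex :: "complex \<Rightarrow> complex \<Rightarrow> complex" where
  [simp]: "scaleC_complex a x = a * x"

instance
  by standard (simp_all add: algebra_simps)

end

instantiation poly_mapping :: (type, complex_vector) complex_vector
begin

definition scaleC_poly_mapping :: "complex \<Rightarrow> ('a \<Rightarrow>\<^sub>0 'b) \<Rightarrow> ('a \<Rightarrow>\<^sub>0 'b)" where
  "scaleC_poly_mapping c p = Poly_Mapping.map (scaleC c) p"

lemma lookup_scaleC:
  "Poly_Mapping.lookup (c *\<^sub>C p) k = c *\<^sub>C Poly_Mapping.lookup p k" for p :: "'a \<Rightarrow>\<^sub>0 'b"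
  unfolding scaleC_poly_mapping_def by transfer (simp add: when_def)

instance
  by standard
    (auto intro!: poly_mapping_eqI
      simp: lookup_scaleC lookup_add scaleC_add_right scaleC_add_left scaleC_scaleC scaleC_one)

end

instance poly_mapping :: (monoid_add, complex_algebra_1) complex_algebra_1
proof
  fix a :: complex and x y :: "'a \<Rightarrow>\<^sub>0 'b"
  have S: "Sum_any (\<lambda>i. a *\<^sub>C f i) = a *\<^sub>C Sum_any f" for f :: "'a \<Rightarrow> 'b"
  proof (cases "a = 0")
    case False
    then have "{i. a *\<^sub>C f i \<noteq> 0} = {i. f i \<noteq> 0}" by simp
    then show ?thesis by (simp add: Sum_any.expand_set cvec.scale_sum_right)
  qed simp
  have W: "(a *\<^sub>C z when P) = a *\<^sub>C (z when P)" for z :: 'b and P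
    by (simp add: when_def)
  show "a *\<^sub>C x * y = a *\<^sub>C (x * y)"
    by (rule poly_mapping_eqI) (simp add: lookup_mult lookup_scaleC mult_scaleC_left S)
  show "x * a *\<^sub>C y = a *\<^sub>C (x * y)"
    by (rule poly_mapping_eqI) (simp add: lookup_mult lookup_scaleC mult_scaleC_right W S)
qed


section \<open>The free unital complex algebra on two generators\<close>

text \<open>Words form the free monoid under concatenation, written additively because the
  convolution product of \<^typ>\<open>'a \<Rightarrow>\<^sub>0 'b\<close> is indexed by additive monoids. The algebra
  is the corresponding monoid algebra.\<close>

instantiation list :: (type) monoid_add
begin

definition zero_list :: "'a list" where "zero_list = []"
definition plus_list :: "'a list \<Rightarrow> 'a list \<Rightarrow> 'a list" where "plus_list = (@)"

instance
  by standard (simp_all add: zero_list_def plus_list_def)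

end

datatype letter = Letter_x | Letter_y

type_synonym free_alg = "letter list \<Rightarrow>\<^sub>0 complex"

definition gen_x :: free_alg where "gen_x = Poly_Mapping.single [Letter_x] 1"
definition gen_y :: free_alg where "gen_y = Poly_Mapping.single [Letter_y] 1"


section \<open>Tensor powers\<close>

text \<open>All tensor powers of the algebra live in the single type \<open>'a tensor\<close>, the direct sum of
  the \<open>n\<close>-fold tensor powers over all \<open>n\<close>: the vector space freely spanned by the lists over
  \<open>'a\<close> modulo linearity in every entry.\<close>

abbreviation formal :: "'a list \<Rightarrow> ('a list \<Rightarrow>\<^sub>0 complex)" where
  "formal xs \<equiv> Poly_Mapping.single xs 1"

definition multilinear_relations :: "('a::complex_vector list \<Rightarrow>\<^sub>0 complex) set" where
  "multilinear_relations =
    {formal (xs[j := x + y]) - (formal (xs[j := x]) + formal (xs[j := y])) |xs j x y.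
       j < length xs} \<union>
    {formal (xs[j := c *\<^sub>C x]) - c *\<^sub>C formal (xs[j := x]) |xs j c x. j < length xs}"

definition tensor_rel ::
  "('a::complex_vector list \<Rightarrow>\<^sub>0 complex) \<Rightarrow> ('a list \<Rightarrow>\<^sub>0 complex) \<Rightarrow> bool" where
  "tensor_rel p q \<longleftrightarrow> p - q \<in> cvec.span multilinear_relations"

lemma equivp_tensor_rel: "equivp tensor_rel" (is "equivp ?R")
proof (rule equivpI)
  show "reflp ?R"
    by (simp add: reflp_def tensor_rel_def cvec.span_zero)
  show "symp ?R"
  proof (rule sympI)
    fix p q
    assume "?R p q"
    then show "?R q p"
      unfolding tensor_rel_def using cvec.span_neg[of "p - q"] by simp
  qed
  show "transp ?R"
  proof (rule transpI)
    fix p q r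
    assume "?R p q" "?R q r"
    then show "?R p r"
      unfolding tensor_rel_def using cvec.span_add[of "p - q" _ "q - r"] by simp
  qed
qed

quotient_type (overloaded) 'a tensor = "'a::complex_vector list \<Rightarrow>\<^sub>0 complex" / tensor_rel
  by (rule equivp_tensor_rel)

instantiation tensor :: (complex_vector) complex_vector
begin

lift_definition zero_tensor :: "'a tensor" is 0 .

lift_definition plus_tensor :: "'a tensor \<Rightarrow> 'a tensor \<Rightarrow> 'a tensor" is "(+)"
proof -
  fix p p' q q' :: "'a list \<Rightarrow>\<^sub>0 complex"
  assume "tensor_rel p p'" "tensor_rel q q'"
  then have "(p - p') + (q - q') \<in> cvec.span multilinear_relations"
    unfolding tensor_rel_def by (rule cvec.span_add)
  then show "tensor_rel (p + q) (p' + q')"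
    unfolding tensor_rel_def by (simp add: algebra_simps)
qed

lift_definition uminus_tensor :: "'a tensor \<Rightarrow> 'a tensor" is uminus
proof -
  fix p p' :: "'a list \<Rightarrow>\<^sub>0 complex"
  assume "tensor_rel p p'"
  then have "- (p - p') \<in> cvec.span multilinear_relations"
    unfolding tensor_rel_def by (rule cvec.span_neg)
  then show "tensor_rel (- p) (- p')"
    unfolding tensor_rel_def by simp
qed

lift_definition minus_tensor :: "'a tensor \<Rightarrow> 'a tensor \<Rightarrow> 'a tensor" is "(-)"
proof -
  fix p p' q q' :: "'a list \<Rightarrow>\<^sub>0 complex"
  assume "tensor_rel p p'" "tensor_rel q q'"
  then have "(p - p') - (q - q') \<in> cvec.span multilinear_relations"
    unfolding tensor_rel_def by (rule cvec.span_diff)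
  then show "tensor_rel (p - q) (p' - q')"
    unfolding tensor_rel_def by (simp add: algebra_simps)
qed

lift_definition scaleC_tensor :: "complex \<Rightarrow> 'a tensor \<Rightarrow> 'a tensor" is scaleC
proof -
  fix c and p p' :: "'a list \<Rightarrow>\<^sub>0 complex"
  assume "tensor_rel p p'"
  then have "c *\<^sub>C (p - p') \<in> cvec.span multilinear_relations"
    unfolding tensor_rel_def by (rule cvec.span_scale)
  then show "tensor_rel (c *\<^sub>C p) (c *\<^sub>C p')"
    unfolding tensor_rel_def by (simp add: cvec.scale_right_diff_distrib)
qed

instance
proof
  fix x y z :: "'a tensor" and a b :: complex
  have [simp]: "tensor_rel p p" for p :: "'a list \<Rightarrow>\<^sub>0 complex"
    by (simp add: tensor_rel_def cvec.span_zero)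
  show "x + y + z = x + (y + z)" by transfer (simp add: add.assoc)
  show "x + y = y + x" by transfer (simp add: add.commute)
  show "0 + x = x" by transfer simp
  show "- x + x = 0" by transfer simp
  show "x - y = x + - y" by transfer simp
  show "a *\<^sub>C (x + y) = a *\<^sub>C x + a *\<^sub>C y" by transfer (simp add: scaleC_add_right)
  show "(a + b) *\<^sub>C x = a *\<^sub>C x + b *\<^sub>C x" by transfer (simp add: scaleC_add_left)
  show "a *\<^sub>C b *\<^sub>C x = (a * b) *\<^sub>C x" by transfer (simp add: scaleC_scaleC)
  show "1 *\<^sub>C x = x" by transfer (simp add: scaleC_one)
qed

end

text \<open>The elementary tensor \<open>x\<^sub>0 \<otimes> \<dots> \<otimes> x\<^sub>k\<close>.\<close>

lift_definition pure :: "'a::complex_vector list \<Rightarrow> 'a tensor" is formal .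


subsection \<open>Linear maps given on elementary tensors\<close>

definition multilinear :: "('a::complex_vector list \<Rightarrow> 'b::complex_vector) \<Rightarrow> bool" where
  "multilinear f \<longleftrightarrow>
    (\<forall>xs j. j < length xs \<longrightarrow>
      (\<forall>x y. f (xs[j := x + y]) = f (xs[j := x]) + f (xs[j := y])) \<and>
      (\<forall>c x. f (xs[j := c *\<^sub>C x]) = c *\<^sub>C f (xs[j := x])))"

definition linear_ext :: "('a list \<Rightarrow> 'b::complex_vector) \<Rightarrow> ('a list \<Rightarrow>\<^sub>0 complex) \<Rightarrow> 'b" where
  "linear_ext f p = (\<Sum>xs\<in>Poly_Mapping.keys p. Poly_Mapping.lookup p xs *\<^sub>C f xs)"

text \<open>Meaningful for multilinear \<open>f\<close> only, when it does not depend on the representative of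
  the class and is the unique linear map sending \<open>pure xs\<close> to \<open>f xs\<close>: see \<open>clinear_tensor_lift\<close>,
  \<open>tensor_lift_pure\<close> and \<open>clinear_eqI\<close>.\<close>

definition tensor_lift ::
  "('a::complex_vector list \<Rightarrow> 'b::complex_vector) \<Rightarrow> 'a tensor \<Rightarrow> 'b" where
  "tensor_lift f z = linear_ext f (rep_tensor z)"

lemma linear_ext_superset:
  assumes "finite S" "Poly_Mapping.keys p \<subseteq> S"
  shows "linear_ext f p = (\<Sum>xs\<in>S. Poly_Mapping.lookup p xs *\<^sub>C f xs)"
  unfolding linear_ext_def using assms
  by (intro sum.mono_neutral_left) (auto simp: in_keys_iff)

lemma clinear_linear_ext: "clinear (linear_ext f)"
  unfolding clinear_def
proof (intro conjI allI)
  fix p q :: "'a list \<Rightarrow>\<^sub>0 complex"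
  let ?S = "Poly_Mapping.keys p \<union> Poly_Mapping.keys q"
  have "Poly_Mapping.keys (p + q) \<subseteq> ?S" by (rule Poly_Mapping.keys_add)
  then show "linear_ext f (p + q) = linear_ext f p + linear_ext f q"
    by (simp add: linear_ext_superset[of ?S] lookup_add scaleC_add_left sum.distrib)
next
  fix c and p :: "'a list \<Rightarrow>\<^sub>0 complex"
  have "Poly_Mapping.keys (c *\<^sub>C p) \<subseteq> Poly_Mapping.keys p"
    by (auto simp: in_keys_iff lookup_scaleC)
  then show "linear_ext f (c *\<^sub>C p) = c *\<^sub>C linear_ext f p"
    by (simp add: linear_ext_superset[of "Poly_Mapping.keys p"] lookup_scaleC
        cvec.scale_sum_right scaleC_scaleC)
qed

lemma linear_ext_formal: "linear_ext f (formal xs) = f xs"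
  by (simp add: linear_ext_def scaleC_one)

lemma clinear_add: "clinear f \<Longrightarrow> f (x + y) = f x + f y"
  and clinear_scaleC: "clinear f \<Longrightarrow> f (c *\<^sub>C x) = c *\<^sub>C f x"
  by (simp_all add: clinear_def)

lemma clinear_0: "clinear f \<Longrightarrow> f 0 = 0"
  by (metis add_cancel_right_right clinear_add)

lemma clinear_diff: "clinear f \<Longrightarrow> f (x - y) = f x - f y"
  by (metis add_diff_cancel diff_add_cancel clinear_add)

lemma clinear_minus: "clinear f \<Longrightarrow> f (- x) = - f x"
  by (metis clinear_0 clinear_diff diff_0)

lemma linear_ext_rel:
  assumes f: "multilinear f" and "tensor_rel p q"
  shows "linear_ext f p = linear_ext f q"
proof -
  note L = clinear_linear_ext[of f]
  have "linear_ext f r = 0" if "r \<in> cvec.span multilinear_relations" for r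
    using that
  proof (induction rule: cvec.span_induct_alt)
    case base
    show ?case by (rule clinear_0[OF L])
  next
    case (step c r s)
    have "linear_ext f r = 0"
      using step(1) f unfolding multilinear_relations_def multilinear_def
      by (auto simp: clinear_add[OF L] clinear_diff[OF L] clinear_scaleC[OF L] linear_ext_formal)
    then show ?case
      using step by (simp add: clinear_add[OF L] clinear_scaleC[OF L])
  qed
  then have "linear_ext f (p - q) = 0"
    using assms(2) by (simp add: tensor_rel_def)
  then show ?thesis by (simp add: clinear_diff[OF L])
qed

lemma tensor_lift_abs:
  assumes "multilinear f"
  shows "tensor_lift f (abs_tensor p) = linear_ext f p"
  unfolding tensor_lift_def
  by (rule linear_ext_rel[OF assms])
    (rule Quotient3_rep_abs[OF Quotient3_tensor equivp_reflp[OF equivp_tensor_rel]])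

lemma clinear_tensor_lift:
  assumes "multilinear f"
  shows "clinear (tensor_lift f)"
  unfolding clinear_def
proof (intro conjI allI)
  fix x y :: "'a tensor" and c
  obtain p q where [simp]: "x = abs_tensor p" "y = abs_tensor q"
    using Quotient3_abs_rep[OF Quotient3_tensor, of x, symmetric]
      Quotient3_abs_rep[OF Quotient3_tensor, of y, symmetric] by (rule that)
  show "tensor_lift f (x + y) = tensor_lift f x + tensor_lift f y"
    by (simp add: plus_tensor.abs_eq tensor_lift_abs[OF assms] clinear_add[OF clinear_linear_ext])
  show "tensor_lift f (c *\<^sub>C x) = c *\<^sub>C tensor_lift f x"
    by (simp add: scaleC_tensor.abs_eq tensor_lift_abs[OF assms]
        clinear_scaleC[OF clinear_linear_ext])
qed

lemma tensor_lift_pure: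
  assumes "multilinear f"
  shows "tensor_lift f (pure xs) = f xs"
  by (simp add: pure.abs_eq tensor_lift_abs[OF assms] linear_ext_formal)

lemma pure_update_add:
  "j < length xs \<Longrightarrow> pure (xs[j := x + y]) = pure (xs[j := x]) + pure (xs[j := y])"
  by transfer
    (unfold tensor_rel_def, rule cvec.span_base, unfold multilinear_relations_def, blast)

lemma pure_update_scaleC:
  "j < length xs \<Longrightarrow> pure (xs[j := c *\<^sub>C x]) = c *\<^sub>C pure (xs[j := x])"
  by transfer
    (unfold tensor_rel_def, rule cvec.span_base, unfold multilinear_relations_def, blast)

lemma multilinear_pure: "multilinear pure"
  by (simp add: multilinear_def pure_update_add pure_update_scaleC)

lemma clinear_eqI:
  assumes "clinear f" "clinear g" "\<And>xs. f (pure xs) = g (pure xs)"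
  shows "f z = g z"
proof -
  obtain p where z: "z = abs_tensor p"
    using Quotient3_abs_rep[OF Quotient3_tensor, of z, symmetric] by (rule that)
  have "f (abs_tensor p) = g (abs_tensor p)"
  proof (induction p rule: update_induct)
    case const
    show ?case
      using assms(1,2) by (simp add: zero_tensor.abs_eq[symmetric] clinear_0)
  next
    case (update p xs c)
    have "Poly_Mapping.update xs c p = p + c *\<^sub>C formal xs"
      using update.hyps
      by (intro poly_mapping_eqI)
        (auto simp: lookup_update lookup_add lookup_scaleC lookup_single in_keys_iff when_def)
    then have "abs_tensor (Poly_Mapping.update xs c p) = abs_tensor p + c *\<^sub>C pure xs"
      by (simp only: scaleC_tensor.abs_eq pure.abs_eq plus_tensor.abs_eq)
    then show ?case
      using assms update.IH by (simp add: clinear_add clinear_scaleC)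
  qed
  then show ?thesis by (simp add: z)
qed


section \<open>Hochschild and Connes boundaries\<close>

text \<open>\<open>(-1)\<^sup>i z\<close>\<close>

abbreviation signed :: "nat \<Rightarrow> 'a::complex_vector \<Rightarrow> 'a" where
  "signed i z \<equiv> (- 1) ^ i *\<^sub>C z"

text \<open>In the next three definitions \<open>k = length xs - 1\<close> is the degree of \<open>pure xs\<close>.
  The boundary vanishes in degree 0, because there is no chain in degree \<open>-1\<close>.\<close>

definition hochschild_b :: "'a::complex_algebra_1 tensor \<Rightarrow> 'a tensor" where
  "hochschild_b = tensor_lift (\<lambda>xs. let k = length xs - 1 in
     if k = 0 then 0
     else (\<Sum>i<k. signed i (pure (take i xs @ (xs ! i * xs ! (i + 1)) # drop (i + 2) xs)))
       + signed k (pure ((last xs * hd xs) # butlast (tl xs))))"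

definition cyclic_t :: "'a::complex_algebra_1 tensor \<Rightarrow> 'a tensor" where
  "cyclic_t = tensor_lift (\<lambda>xs. signed (length xs - 1) (pure (last xs # butlast xs)))"

definition norm_N :: "'a::complex_algebra_1 tensor \<Rightarrow> 'a tensor" where
  "norm_N = tensor_lift (\<lambda>xs. \<Sum>i\<le>length xs - 1. (cyclic_t ^^ i) (pure xs))"

definition degeneracy_s :: "'a::complex_algebra_1 tensor \<Rightarrow> 'a tensor" where
  "degeneracy_s = tensor_lift (\<lambda>xs. pure (1 # xs))"

definition connes_B :: "'a::complex_algebra_1 tensor \<Rightarrow> 'a tensor" where
  "connes_B z = degeneracy_s (norm_N z) - cyclic_t (degeneracy_s (norm_N z))"

subsection \<open>Well-definedness\<close>

lemma multilinear_sum: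
  "(\<And>i. i \<in> S \<Longrightarrow> multilinear (f i)) \<Longrightarrow> multilinear (\<lambda>xs. \<Sum>i\<in>S. f i xs)"
  by (simp add: multilinear_def sum.distrib cvec.scale_sum_right)

lemma multilinear_clinear: "clinear g \<Longrightarrow> multilinear f \<Longrightarrow> multilinear (\<lambda>xs. g (f xs))"
  by (simp add: multilinear_def clinear_add clinear_scaleC)

lemma clinear_funpow: "clinear f \<Longrightarrow> clinear (f ^^ i)" for f :: "'a \<Rightarrow> 'a::complex_vector"
  by (induction i) (simp_all add: clinear_def)

lemma multilinear_degreewise:
  "(\<And>n. multilinear (g n)) \<Longrightarrow> multilinear (\<lambda>xs. g (length xs) xs)"
  by (simp add: multilinear_def)

lemma multilinear_signed: "multilinear f \<Longrightarrow> multilinear (\<lambda>xs. signed i (f xs))"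
  by (simp add: multilinear_def scaleC_add_right cvec.scale_left_commute)

lemma multilinear_rotate:
  assumes "multilinear f"
  shows "multilinear (\<lambda>xs. f (last xs # butlast xs))"
proof -
  let ?r = "\<lambda>xs. last xs # butlast xs"
  let ?p = "\<lambda>xs j. if j = length xs - 1 then 0 else Suc j"
  have upd: "?r (xs[j := x]) = (?r xs)[?p xs j := x]" if "j < length xs"
    for xs :: "'a list" and j x
    using that by (cases xs rule: rev_cases) (auto simp: list_update_append)
  have len: "?p xs j < length (?r xs)" if "j < length xs" for xs :: "'a list" and j
    using that by auto
  show ?thesis
    unfolding multilinear_def
  proof (intro allI impI conjI)
    fix xs :: "'a list" and j x y c
    assume j: "j < length xs"
    show "f (?r (xs[j := x + y])) = f (?r (xs[j := x])) + f (?r (xs[j := y]))"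
      and "f (?r (xs[j := c *\<^sub>C x])) = c *\<^sub>C f (?r (xs[j := x]))"
      using assms len[OF j] unfolding upd[OF j] multilinear_def by blast+
  qed
qed

lemma multilinear_cyclic:
  "multilinear (\<lambda>xs. signed (length xs - 1) (pure (last xs # butlast xs)))"
  by (rule multilinear_degreewise[of "\<lambda>n xs. signed (n - 1) (pure (last xs # butlast xs))"])
    (intro multilinear_signed multilinear_rotate multilinear_pure)

lemma multilinear_cons: "multilinear (\<lambda>xs. pure (a # xs))"
proof -
  have R: "a # xs[j := x] = (a # xs)[Suc j := x]" for xs j x by simp
  show ?thesis
    unfolding multilinear_def R by (simp add: pure_update_add pure_update_scaleC del: list_update.simps)
qed

lemma pure_mid_add: "pure (us @ (x + y) # vs) = pure (us @ x # vs) + pure (us @ y # vs)"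
  using pure_update_add[of "length us" "us @ x # vs" x y] by simp

lemma pure_mid_scaleC: "pure (us @ (c *\<^sub>C x) # vs) = c *\<^sub>C pure (us @ x # vs)"
  using pure_update_scaleC[of "length us" "us @ x # vs" c x] by simp

lemma multilinear_face:
  "multilinear (\<lambda>xs :: 'a::complex_algebra_1 list. if Suc i < length xs
     then pure (take i xs @ (xs ! i * xs ! (i + 1)) # drop (i + 2) xs) else 0)"
  (is "multilinear (\<lambda>xs. if _ xs then pure (?face xs) else 0)")
proof -
  have before: "?face (xs[j := x]) = (?face xs)[j := x]"
    if "j < i" "Suc i < length xs" for xs :: "'a list" and j x
    using that by (simp add: list_update_append take_update_swap)
  have at1: "?face (xs[i := x]) = take i xs @ (x * xs ! (i + 1)) # drop (i + 2) xs"
    if "Suc i < length xs" for xs :: "'a list" and x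
    using that by simp
  have at2: "?face (xs[Suc i := x]) = take i xs @ (xs ! i * x) # drop (i + 2) xs"
    if "Suc i < length xs" for xs :: "'a list" and x
    using that by simp
  have after: "?face (xs[j := x]) = (?face xs)[j - 1 := x]"
    if "Suc i < j" "j < length xs" for xs :: "'a list" and j x
  proof -
    from that(1) obtain m where "j = Suc (Suc (i + m))"
      by (auto dest: less_imp_Suc_add)
    then show ?thesis using that(2) by (simp add: list_update_append drop_update_swap)
  qed
  have A: "pure (?face (xs[j := x + y])) = pure (?face (xs[j := x])) + pure (?face (xs[j := y]))"
    and B: "pure (?face (xs[j := c *\<^sub>C x])) = c *\<^sub>C pure (?face (xs[j := x]))"
    if "j < length xs" "Suc i < length xs" for xs :: "'a list" and j x y c
  proof -
    consider "j < i" | "j = i" | "j = Suc i" | "Suc i < j" by linarith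
    note C = this
    show "pure (?face (xs[j := x + y])) = pure (?face (xs[j := x])) + pure (?face (xs[j := y]))"
    proof (cases rule: C)
      case 1
      then have "j < length (?face xs)" using that by simp
      from pure_update_add[OF this] show ?thesis using 1 that by (simp only: before)
    next
      case 2
      then show ?thesis using that by (simp only: at1 distrib_right pure_mid_add)
    next
      case 3
      then show ?thesis using that by (simp only: at2 distrib_left pure_mid_add)
    next
      case 4
      then have "j - 1 < length (?face xs)" using that by simp
      from pure_update_add[OF this] show ?thesis using 4 that by (simp only: after)
    qed
    show "pure (?face (xs[j := c *\<^sub>C x])) = c *\<^sub>C pure (?face (xs[j := x]))"
    proof (cases rule: C)
      case 1
      then have "j < length (?face xs)" using that by simp
      from pure_update_scaleC[OF this] show ?thesis using 1 that by (simp only: before)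
    next
      case 2
      then show ?thesis using that by (simp only: at1 mult_scaleC_left pure_mid_scaleC)
    next
      case 3
      then show ?thesis using that by (simp only: at2 mult_scaleC_right pure_mid_scaleC)
    next
      case 4
      then have "j - 1 < length (?face xs)" using that by simp
      from pure_update_scaleC[OF this] show ?thesis using 4 that by (simp only: after)
    qed
  qed
  show ?thesis
    unfolding multilinear_def using A B by simp
qed

lemma multilinear_last_face:
  "multilinear (\<lambda>xs :: 'a::complex_algebra_1 list. if Suc 0 < length xs
     then pure ((last xs * hd xs) # butlast (tl xs)) else 0)"
proof -
  have eq: "(if Suc 0 < length xs then pure ((last xs * hd xs) # butlast (tl xs)) else 0) =
      (let ys = last xs # butlast xs in if Suc 0 < length ys
       then pure (take 0 ys @ (ys ! 0 * ys ! (0 + 1)) # drop (0 + 2) ys) else 0)"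
    for xs :: "'a list"
    by (cases xs; cases "tl xs") (auto simp: Let_def)
  show ?thesis
    using multilinear_rotate[OF multilinear_face[of 0]] unfolding eq Let_def .
qed

lemma multilinear_hochschild:
  "multilinear (\<lambda>xs :: 'a::complex_algebra_1 list. let k = length xs - 1 in
     if k = 0 then 0
     else (\<Sum>i<k. signed i (pure (take i xs @ (xs ! i * xs ! (i + 1)) # drop (i + 2) xs)))
       + signed k (pure ((last xs * hd xs) # butlast (tl xs))))"
  (is "multilinear ?f")
proof -
  let ?F = "\<lambda>i (xs :: 'a list). if Suc i < length xs
     then pure (take i xs @ (xs ! i * xs ! (i + 1)) # drop (i + 2) xs) else 0"
  let ?L = "\<lambda>xs :: 'a list. if Suc 0 < length xs then pure ((last xs * hd xs) # butlast (tl xs)) else 0"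
  let ?g = "\<lambda>n xs. if n - 1 = 0 then 0
     else (\<Sum>i<n - 1. signed i (?F i xs)) + signed (n - 1) (?L xs)"
  have add: "multilinear (\<lambda>xs. f xs + g xs)" if "multilinear f" "multilinear g"
    for f g :: "'a list \<Rightarrow> 'a tensor"
    using that by (simp add: multilinear_def algebra_simps scaleC_add_right)
  have "multilinear (\<lambda>xs. (\<Sum>i<n - 1. signed i (?F i xs)) + signed (n - 1) (?L xs))" for n
    by (intro add multilinear_sum multilinear_signed multilinear_face multilinear_last_face)
  then have "multilinear (?g n)" for n
    by (cases "n - 1 = 0") (simp_all add: multilinear_def)
  then have "multilinear (\<lambda>xs. ?g (length xs) xs)"
    by (rule multilinear_degreewise)
  also have "(\<lambda>xs. ?g (length xs) xs) = ?f"
    by (auto simp: fun_eq_iff Let_def intro!: sum.cong)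
  finally show ?thesis .
qed

lemma clinear_cyclic_t: "clinear cyclic_t"
  unfolding cyclic_t_def by (rule clinear_tensor_lift[OF multilinear_cyclic])

lemma multilinear_norm:
  "multilinear (\<lambda>xs. \<Sum>i\<le>length xs - 1. (cyclic_t ^^ i) (pure xs))"
  by (rule multilinear_degreewise[of "\<lambda>n xs. \<Sum>i\<le>n - 1. (cyclic_t ^^ i) (pure xs)"],
      rule multilinear_sum,
      rule multilinear_clinear[OF clinear_funpow[OF clinear_cyclic_t] multilinear_pure])

lemmas hochschild_b_pure = tensor_lift_pure[OF multilinear_hochschild, folded hochschild_b_def]
  and cyclic_t_pure = tensor_lift_pure[OF multilinear_cyclic, folded cyclic_t_def]
  and norm_N_pure = tensor_lift_pure[OF multilinear_norm, folded norm_N_def]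
  and degeneracy_s_pure = tensor_lift_pure[OF multilinear_cons, folded degeneracy_s_def]

lemmas clinear_hochschild_b =
    clinear_tensor_lift[OF multilinear_hochschild, folded hochschild_b_def]
  and clinear_norm_N = clinear_tensor_lift[OF multilinear_norm, folded norm_N_def]
  and clinear_degeneracy_s = clinear_tensor_lift[OF multilinear_cons, folded degeneracy_s_def]


section \<open>Ideals, relative chains and the concatenation\<close>

definition two_sided_ideal :: "'a::ring_1 set \<Rightarrow> bool" where
  "two_sided_ideal I \<longleftrightarrow> 0 \<in> I \<and> (\<forall>x\<in>I. \<forall>y\<in>I. x + y \<in> I) \<and>
    (\<forall>a. \<forall>x\<in>I. a * x \<in> I \<and> x * a \<in> I)"

text \<open>The space \<open>C\<^sub>k(A, I)\<close>; the degree is an integer, so that \<open>C\<^sub>k\<close> is also available,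
  and zero, for \<open>k < 0\<close>.\<close>

definition rel_chains :: "int \<Rightarrow> 'a::complex_algebra_1 set \<Rightarrow> 'a tensor set" where
  "rel_chains k I =
    (if k < 0 then {0}
     else cvec.span {pure xs |xs. int (length xs) = k + 1 \<and> (\<exists>x\<in>set xs. x \<in> I)})"

text \<open>Row \<open>k\<close>, column \<open>m\<close> of the bicomplex.\<close>

definition concat_entry ::
  "'a::complex_algebra_1 set \<Rightarrow> 'a set \<Rightarrow> int \<Rightarrow> nat \<Rightarrow> 'a tensor set" where
  "concat_entry I J k m = rel_chains (k - int m) (if m = 0 then I else J)"

text \<open>Totalization: a chain \<open>z\<close> of degree \<open>k\<close> is the family of its components \<open>z m\<close> in column
  \<open>m\<close> and row \<open>k - m\<close>, so that \<open>z m\<close> has Hochschild degree \<open>k - 2 m\<close>.\<close>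

definition concat_chains ::
  "'a::complex_algebra_1 set \<Rightarrow> 'a set \<Rightarrow> int \<Rightarrow> (nat \<Rightarrow> 'a tensor) set" where
  "concat_chains I J k = {z. \<forall>m. z m \<in> concat_entry I J (k - int m) m}"

definition concat_boundary ::
  "(nat \<Rightarrow> 'a::complex_algebra_1 tensor) \<Rightarrow> (nat \<Rightarrow> 'a tensor)" where
  "concat_boundary z = (\<lambda>m. hochschild_b (z m) + connes_B (z (Suc m)))"

definition concat_cycles ::
  "'a::complex_algebra_1 set \<Rightarrow> 'a set \<Rightarrow> int \<Rightarrow> (nat \<Rightarrow> 'a tensor) set" where
  "concat_cycles I J k = {z \<in> concat_chains I J k. concat_boundary z = (\<lambda>_. 0)}"


section \<open>The elements and ideals of the statement\<close>

definition elt_v :: free_alg where "elt_v = 1 - gen_x * gen_y"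
definition elt_w :: free_alg where "elt_w = 1 - gen_y * gen_x"

definition omega :: "nat \<Rightarrow> free_alg" where
  "omega n = (\<Sum>i<n. elt_v ^ i * gen_x)"

definition ideal_I :: "nat \<Rightarrow> free_alg set" where
  "ideal_I n = two_sided_ideal hull {elt_v ^ n, elt_w ^ n}"

definition ideal_J :: "nat \<Rightarrow> free_alg set" where
  "ideal_J n = two_sided_ideal hull {elt_w ^ n - elt_v ^ n}"

definition gamma0 :: "nat \<Rightarrow> free_alg" where
  "gamma0 n = elt_w ^ n - elt_v ^ n"

definition gamma2 :: "nat \<Rightarrow> free_alg tensor" where
  "gamma2 n =
    - pure [elt_w ^ n, gen_y, omega n] + pure [elt_v ^ n, omega n, gen_y]
    - pure [omega n, elt_w ^ n, gen_y] + pure [omega n, gen_y, elt_v ^ n]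
    - 2 *\<^sub>C pure [elt_w ^ n - elt_v ^ n, 1, 1]"

text \<open>The degree 2 chain \<open>(\<gamma>\<^sub>2, \<gamma>\<^sub>0)\<close>; an algebra element is a 0-chain through the
  one-fold tensor power.\<close>

definition gamma :: "nat \<Rightarrow> nat \<Rightarrow> free_alg tensor" where
  "gamma n = (\<lambda>_. 0)(0 := gamma2 n, 1 := pure [gamma0 n])"

end

theory Submission
  imports Defs
begin

text \<open>
  Write \<open>V = v\<^sup>n\<close>, \<open>W = w\<^sup>n\<close> and \<open>\<omega> = \<omega>\<^sub>n\<close>. Modulo the ideal \<open>I\<^sub>n\<close> the element \<open>y\<close> is
  invertible with inverse \<open>\<omega>\<close>, and the failure of invertibility in the algebra itself is
  measured exactly:
  \<open>\<omega> y = 1 - V\<close> (a geometric sum in \<open>v = 1 - x y\<close>) and \<open>y \<omega> = 1 - W\<close>. Associativity of the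
  products \<open>\<omega> y \<omega>\<close> and \<open>y \<omega> y\<close> then forces \<open>\<omega> W = V \<omega>\<close> and \<open>y V = W y\<close>. These identities are
  all that the cycle condition uses, so it is proved for arbitrary elements \<open>y\<close>, \<open>\<omega>\<close>, \<open>V\<close>, \<open>W\<close>
  of a complex algebra with \<open>\<omega> y = 1 - V\<close> and \<open>y \<omega> = 1 - W\<close>
  (\<open>hochschild_b_near_inverse_chain\<close>).

  In the Hochschild boundary of the first four summands of \<open>\<gamma>\<^sub>2\<close>, the intertwining identities
  cancel every tensor that contains \<open>y\<close> or \<open>\<omega>\<close>, and the tensors \<open>V \<otimes> V\<close> and \<open>W \<otimes> W\<close> cancel in
  pairs. What survives is \<open>g \<otimes> 1 - 1 \<otimes> g\<close> with \<open>g = W - V\<close>. The fifth summand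
  contributes \<open>- 2 g \<otimes> 1\<close>, so that \<open>b \<gamma>\<^sub>2 = - (1 \<otimes> g + g \<otimes> 1)\<close>. This is \<open>- B g\<close>, since on
  degree 0 the operator \<open>B\<close> is \<open>1 - t\<close> after prefixing \<open>1\<close>
  (\<open>connes_B_degree_0\<close>). The remaining component of the boundary is \<open>b g\<close>, which vanishes for
  degree reasons.
\<close>

section \<open>Ideals and relative chains\<close>

text \<open>The hull is an intersection of ideals, hence an ideal; this is what makes the
  ideals generated by given elements available as ideals.\<close>

lemma two_sided_ideal_hull: "two_sided_ideal (two_sided_ideal hull S)"
  by (rule hull_in) (auto simp: two_sided_ideal_def)

lemma two_sided_ideal_diff:
  assumes "two_sided_ideal I" "x \<in> I" "y \<in> I"
  shows "x - y \<in> I"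
proof -
  have "-1 * y \<in> I"
    using assms(1,3) unfolding two_sided_ideal_def by blast
  then have "x + -1 * y \<in> I"
    using assms(1,2) unfolding two_sided_ideal_def by blast
  then show ?thesis by simp
qed

lemma pure_in_rel_chains:
  assumes "int (length xs) = k + 1" "0 \<le> k" "\<exists>x\<in>set xs. x \<in> I"
  shows "pure xs \<in> rel_chains k I"
  using assms by (auto simp: rel_chains_def intro!: cvec.span_base)

lemma zero_in_rel_chains: "0 \<in> rel_chains k I"
  by (simp add: rel_chains_def cvec.span_zero)

lemma rel_chains_add: "a \<in> rel_chains k I \<Longrightarrow> b \<in> rel_chains k I \<Longrightarrow> a + b \<in> rel_chains k I"
  by (auto simp: rel_chains_def intro: cvec.span_add split: if_splits)

lemma rel_chains_scaleC: "a \<in> rel_chains k I \<Longrightarrow> c *\<^sub>C a \<in> rel_chains k I"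
  by (auto simp: rel_chains_def intro: cvec.span_scale split: if_splits)

lemma rel_chains_minus: "a \<in> rel_chains k I \<Longrightarrow> - a \<in> rel_chains k I"
  by (auto simp: rel_chains_def intro: cvec.span_neg split: if_splits)

lemma rel_chains_diff: "a \<in> rel_chains k I \<Longrightarrow> b \<in> rel_chains k I \<Longrightarrow> a - b \<in> rel_chains k I"
  by (auto simp: rel_chains_def intro: cvec.span_diff split: if_splits)


section \<open>The boundaries in low degree\<close>

lemma pure_pair_diff_left: "pure [x - y, z] = pure [x, z] - pure [y, z]"
  using pure_mid_add[of "[]" "x - y" y "[z]"] by simp

lemma pure_pair_diff_right: "pure [z, x - y] = pure [z, x] - pure [z, y]"
  using pure_mid_add[of "[z]" "x - y" y "[]"] by simp

lemma hochschild_b_degree_0: "hochschild_b (pure [a]) = 0"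
  by (simp add: hochschild_b_pure)

lemma hochschild_b_degree_2:
  "hochschild_b (pure [a, b, c]) = pure [a * b, c] - pure [a, b * c] + pure [c * a, b]"
  by (simp add: hochschild_b_pure lessThan_Suc numeral_2_eq_2 scaleC_one cvec.scale_minus_left)

lemma cyclic_t_degree_1: "cyclic_t (pure [a, b]) = - pure [b, a]"
  unfolding cyclic_t_def cyclic_t_pure by (simp add: scaleC_one cvec.scale_minus_left)

text \<open>On degree 0 the norm is the identity, and on degree 1 the cyclic operator \<open>t\<close> is minus the
  flip, whence the plus sign.\<close>

lemma connes_B_degree_0: "connes_B (pure [a]) = pure [1, a] + pure [a, 1]"
  by (simp add: connes_B_def norm_N_pure degeneracy_s_def degeneracy_s_pure cyclic_t_degree_1)

lemma connes_B_zero: "connes_B 0 = 0"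
  by (simp add: connes_B_def degeneracy_s_def clinear_0[OF clinear_norm_N]
      clinear_0[OF clinear_degeneracy_s] clinear_0[OF clinear_cyclic_t])

text \<open>Associativity of \<open>u y u\<close> and \<open>y u y\<close> gives \<open>u W = V u\<close> and \<open>y V = W y\<close>. After these
  rewrites all terms with a factor \<open>u\<close> or \<open>y\<close> cancel, and only tensors in \<open>1\<close>, \<open>V\<close>, \<open>W\<close> remain.\<close>

lemma hochschild_b_near_inverse_chain:
  fixes y u V W :: "'a::complex_algebra_1"
  assumes uy: "u * y = 1 - V" and yu: "y * u = 1 - W"
  shows "hochschild_b (- pure [W, y, u] + pure [V, u, y] - pure [u, W, y] + pure [u, y, V]
      - 2 *\<^sub>C pure [W - V, 1, 1])
    = - connes_B (pure [W - V])"
proof -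
  have "u * (y * u) = (u * y) * u"
    by (simp only: mult.assoc)
  then have uW: "u * W = V * u"
    by (simp add: uy yu algebra_simps)
  have "y * (u * y) = (y * u) * y"
    by (simp only: mult.assoc)
  then have yV: "y * V = W * y"
    by (simp add: uy yu algebra_simps)
  have two: "2 *\<^sub>C z = z + z" for z :: "'a tensor"
    using scaleC_add_left[of 1 1 z] by (simp add: scaleC_one)
  note lin = clinear_add[OF clinear_hochschild_b] clinear_diff[OF clinear_hochschild_b]
    clinear_minus[OF clinear_hochschild_b]
  show ?thesis
    by (simp add: two lin hochschild_b_degree_2 connes_B_degree_0 uy yu uW yV
        pure_pair_diff_left pure_pair_diff_right algebra_simps)
qed


section \<open>The free algebra\<close>

lemma omega_mult_y: "omega n * gen_y = 1 - elt_v ^ n"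
proof -
  have "omega n * gen_y = (\<Sum>i<n. elt_v ^ i - elt_v ^ Suc i)"
    unfolding omega_def sum_distrib_right
    by (intro sum.cong refl) (simp add: elt_v_def algebra_simps power_Suc2 del: power_Suc)
  also have "\<dots> = 1 - elt_v ^ n"
    using sum_lessThan_telescope'[of "\<lambda>i. elt_v ^ i" n] by simp
  finally show ?thesis .
qed

lemma y_mult_elt_v_power: "gen_y * elt_v ^ i = elt_w ^ i * gen_y"
proof (induction i)
  case (Suc i)
  have *: "gen_y * elt_v = elt_w * gen_y"
    by (simp add: elt_v_def elt_w_def algebra_simps)
  have "gen_y * elt_v ^ Suc i = elt_w * (gen_y * elt_v ^ i)"
    by (simp add: * mult.assoc[symmetric])
  then show ?case
    by (simp add: Suc.IH mult.assoc)
qed simp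

text \<open>Moving \<open>y\<close> past the powers of \<open>v\<close> turns this into a geometric sum in \<open>w\<close>.\<close>

lemma y_mult_omega: "gen_y * omega n = 1 - elt_w ^ n"
proof -
  have "gen_y * (elt_v ^ i * gen_x) = elt_w ^ i - elt_w ^ Suc i" for i
  proof -
    have "gen_y * (elt_v ^ i * gen_x) = elt_w ^ i * (gen_y * gen_x)"
      by (simp add: mult.assoc[symmetric] y_mult_elt_v_power)
    also have "\<dots> = elt_w ^ i * (1 - elt_w)"
      by (simp add: elt_w_def)
    finally show ?thesis
      by (simp add: right_diff_distrib power_Suc2 del: power_Suc)
  qed
  then have "gen_y * omega n = (\<Sum>i<n. elt_w ^ i - elt_w ^ Suc i)"
    unfolding omega_def sum_distrib_left by simp
  also have "\<dots> = 1 - elt_w ^ n"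
    using sum_lessThan_telescope'[of "\<lambda>i. elt_w ^ i" n] by simp
  finally show ?thesis .
qed

lemma elt_powers_in_ideal_I: "elt_v ^ n \<in> ideal_I n" "elt_w ^ n \<in> ideal_I n"
  using hull_subset[of "{elt_v ^ n, elt_w ^ n}" two_sided_ideal] by (auto simp: ideal_I_def)

lemma gamma0_in_ideal_I: "gamma0 n \<in> ideal_I n"
  unfolding gamma0_def
  by (rule two_sided_ideal_diff[OF _ elt_powers_in_ideal_I(2,1)])
    (simp add: ideal_I_def two_sided_ideal_hull)

lemma ideal_J_subset_ideal_I: "ideal_J n \<subseteq> ideal_I n"
  using gamma0_in_ideal_I[of n] unfolding ideal_J_def gamma0_def
  by (intro hull_minimal) (simp_all add: ideal_I_def two_sided_ideal_hull)

lemma gamma0_in_ideal_J: "gamma0 n \<in> ideal_J n"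
  unfolding ideal_J_def gamma0_def by (rule hull_inc) simp

lemma gamma2_in_rel_chains: "gamma2 n \<in> rel_chains 2 (ideal_I n)"
  unfolding gamma2_def
  by (intro rel_chains_add rel_chains_diff rel_chains_minus rel_chains_scaleC pure_in_rel_chains)
    (simp_all add: elt_powers_in_ideal_I gamma0_in_ideal_I[unfolded gamma0_def])

lemma gamma_in_concat_chains: "gamma n \<in> concat_chains (ideal_I n) (ideal_J n) 2"
  unfolding concat_chains_def concat_entry_def
proof (intro CollectI allI)
  fix m :: nat
  consider "m = 0" | "m = 1" | "m \<ge> 2"
    by linarith
  then show "gamma n m \<in> rel_chains (2 - int m - int m) (if m = 0 then ideal_I n else ideal_J n)"
  proof cases
    case 1
    then show ?thesis
      by (simp add: gamma_def gamma2_in_rel_chains)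
  next
    case 2
    then show ?thesis
      by (simp add: gamma_def pure_in_rel_chains gamma0_in_ideal_J)
  next
    case 3
    then show ?thesis
      by (simp add: gamma_def zero_in_rel_chains)
  qed
qed

lemma concat_boundary_gamma: "concat_boundary (gamma n) = (\<lambda>_. 0)"
proof
  fix m :: nat
  consider "m = 0" | "m = 1" | "m \<ge> 2"
    by linarith
  then show "concat_boundary (gamma n) m = 0"
  proof cases
    case 1
    have "hochschild_b (gamma2 n) = - connes_B (pure [gamma0 n])"
      unfolding gamma2_def gamma0_def
      by (rule hochschild_b_near_inverse_chain[OF omega_mult_y y_mult_omega])
    then show ?thesis
      using 1 by (simp add: concat_boundary_def gamma_def)
  next
    case 2
    then show ?thesis
      by (simp add: concat_boundary_def gamma_def hochschild_b_degree_0 connes_B_zero)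
  next
    case 3
    then show ?thesis
      by (simp add: concat_boundary_def gamma_def clinear_0[OF clinear_hochschild_b]
          connes_B_zero)
  qed
qed

theorem proposition3p1:
  fixes n :: nat
  assumes "n \<ge> 1"
  shows "ideal_J n \<subseteq> ideal_I n \<and>
    gamma2 n \<in> rel_chains 2 (ideal_I n) \<and>
    gamma0 n \<in> ideal_J n \<and>
    gamma n \<in> concat_cycles (ideal_I n) (ideal_J n) 2"
  by (simp add: ideal_J_subset_ideal_I gamma2_in_rel_chains gamma0_in_ideal_J concat_cycles_def
      gamma_in_concat_chains concat_boundary_gamma)

end
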